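(* Let $k\ge 1$, let $\Omega\subset\mathbb{R}^2$ be open and convex, and let $A\in C^k(\Omega,\mathbb{C}^{2\times 2})$. Let $\xi_0\in\Omega$ be a generic cuspidal point (GCP) of $A$, and suppose that $A(\xi)$ has distinct eigenvalues everywhere else in $\Omega$. Let $\Gamma\subset\Omega$ be a smooth Jordan curve encircling $\xi_0$, parametrized by $\gamma$ in such a way that both $\gamma(\cdot)$ and $A(\gamma(\cdot))$ are $1$-periodic. Let $A(\gamma(t))=V(t)\Lambda(t)V^{-1}(t)$, $t\in\mathbb{R}$, $\Lambda=\mathrm{diag}(\lambda_1,\lambda_2)$, be a $C^k$ parallel-transport eigendecomposition. Then there are constants $\alpha_1,\alpha_2\in\mathbb{R}$ such that, for all $t\in\mathbb{R}$: (i) $\lambda_1(t+1)=\lambda_2(t)$ and $\lambda_2(t+1)=\lambda_1(t)$; (ii) $V^{-1}(t)V(t+1)=\begin{bmatrix}0&e^{i\alpha_2}\\ e^{i\alpha_1}&0\end{bmatrix}$, with $\alpha_1+\alpha_2=\pi \pmod{2\pi}$.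
   Context: GCP for $2\times2$ functions: write $A(\xi)=\begin{bmatrix} a(\xi)&b(\xi)\\ c(\xi)&d(\xi)\end{bmatrix}$, $\Delta(\xi)=(a(\xi)-d(\xi))^2+4b(\xi)c(\xi)$ and $F(\xi)=(\mathrm{Re}\,\Delta(\xi),\mathrm{Im}\,\Delta(\xi))\in\mathbb{R}^2$. A point $\xi_0\in\Omega$ is a GCP of $A$ if $F(\xi_0)=0$ and the Jacobian $DF(\xi_0)$ is invertible. "$p$-periodic" means that $p$ is the minimal positive period. A smooth Jordan curve is a $C^1$, $1$-periodic map $\gamma:\mathbb{R}\to\mathbb{R}^2$ that is one-to-one on $[0,1)$; its image $\Gamma$ is also called a smooth Jordan curve. $\Gamma$ encircles a point if the point lies in the bounded component of $\mathbb{R}^2\setminus\Gamma$. Parallel-transport eigendecomposition: for a matrix function $B(t)\in\mathbb{C}^{n\times n}$ with distinct eigenvalues for all $t$, a $C^k$ eigendecomposition is $B(t)=V(t)\Lambda(t)V^{-1}(t)$ with $V=[v_1,\dots,v_n]$ invertible, $\Lambda=\mathrm{diag}(\lambda_1,\dots,\lambda_n)$, and $V,\Lambda$ of class $C^k$. Put $P(t)=V^{-1}(t)\dot V(t)$. It is called here a parallel-transport eigendecomposition if for all $j$ and $t$: $\mathrm{Re}(v_j^*v_jP_{jj})=-\sum_{l\ne j}\mathrm{Re}(v_j^*v_lP_{lj})$ (equivalently, $\|v_j(t)\|$ is constant in $t$), and $\mathrm{Im}(P_{jj}(t))=0$.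
   Formalization: (ii) as printed fails if the constant norms r1, r2 of the columns of V differ (rescale one column); it is proved as printed when r1 = r2, and in general with the entries e^{iα2}, e^{iα1} multiplied by r2/r1 and r1/r2. *)

theory Defs
  imports "HOL-Analysis.Analysis" "HOL-Library.Real_Mod"
begin

section \<open>Regularity and closed curves\<close>

text \<open>
  \<open>C\<^sup>k\<close> on a set, meant for open sets: all iterated directional derivatives up to order \<open>k\<close>
  exist and the function and these derivatives are continuous. Complex vectors and matrices are
  regarded as real normed spaces, so differentiability is real differentiability.
\<close>

fun Ck_on :: "nat \<Rightarrow> ('a::real_normed_vector \<Rightarrow> 'b::real_normed_vector) \<Rightarrow> 'a set \<Rightarrow> bool" where
  "Ck_on 0 f S \<longleftrightarrow> continuous_on S f"
| "Ck_on (Suc k) f S \<longleftrightarrow>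
     continuous_on S f \<and> (\<forall>x\<in>S. f differentiable (at x)) \<and>
     (\<forall>v. Ck_on k (\<lambda>x. frechet_derivative f (at x) v) S)"

text \<open>Here \<open>p\<close> is the minimal positive period.\<close>

definition periodic_with :: "real \<Rightarrow> (real \<Rightarrow> 'a) \<Rightarrow> bool" where
  "periodic_with p f \<longleftrightarrow> p > 0 \<and> (\<forall>t. f (t + p) = f t) \<and>
     (\<forall>q. 0 < q \<and> q < p \<longrightarrow> \<not> (\<forall>t. f (t + q) = f t))"

definition smooth_Jordan_curve :: "(real \<Rightarrow> real^2) \<Rightarrow> bool" where
  "smooth_Jordan_curve \<gamma> \<longleftrightarrow>
     \<gamma> C1_differentiable_on UNIV \<and> periodic_with 1 \<gamma> \<and> inj_on \<gamma> {0..<1}"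

text \<open>
  \<^const>\<open>inside\<close> \<open>S\<close> is the union of the bounded components of the complement of \<open>S\<close>.
\<close>

definition encircles :: "(real \<Rightarrow> real^2) \<Rightarrow> real^2 \<Rightarrow> bool" where
  "encircles \<gamma> x \<longleftrightarrow> x \<in> inside (range \<gamma>)"

section \<open>Eigenvalues and generic cuspidal points\<close>

definition eigenval :: "complex^'n^'n \<Rightarrow> complex \<Rightarrow> bool" where
  "eigenval M \<mu> \<longleftrightarrow> (\<exists>v. v \<noteq> 0 \<and> M *v v = \<mu> *s v)"

text \<open>An \<open>n \<times> n\<close> matrix has distinct eigenvalues iff it has \<open>n\<close> different ones.\<close>

definition distinct_eigenvals :: "complex^'n^'n \<Rightarrow> bool" where
  "distinct_eigenvals M \<longleftrightarrow> card {\<mu>. eigenval M \<mu>} = CARD('n)"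

definition eig_disc :: "complex^2^2 \<Rightarrow> complex" where
  "eig_disc M = (M$1$1 - M$2$2)^2 + 4 * M$1$2 * M$2$1"

definition disc_map :: "(real^2 \<Rightarrow> complex^2^2) \<Rightarrow> real^2 \<Rightarrow> real^2" where
  "disc_map A \<xi> = vector [Re (eig_disc (A \<xi>)), Im (eig_disc (A \<xi>))]"

text \<open>
  The differentiability clause keeps the Jacobian from being an arbitrary value. It holds
  automatically if \<open>A\<close> is \<open>C\<^sup>1\<close> on the open set \<open>\<Omega>\<close>.
\<close>

definition generic_cuspidal_point :: "(real^2) set \<Rightarrow> (real^2 \<Rightarrow> complex^2^2) \<Rightarrow> real^2 \<Rightarrow> bool" where
  "generic_cuspidal_point \<Omega> A \<xi>0 \<longleftrightarrow>
     \<xi>0 \<in> \<Omega> \<and> disc_map A \<xi>0 = 0 \<and>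
     disc_map A differentiable (at \<xi>0) \<and> invertible (jacobian (disc_map A) (at \<xi>0))"

section \<open>Parallel-transport eigendecompositions\<close>

definition diag_mat :: "complex^'n \<Rightarrow> complex^'n^'n" where
  "diag_mat l = (\<chi> i j. if i = j then l$i else 0)"

text \<open>The product \<open>v\<^sup>* w\<close>, conjugate linear in the first argument.\<close>

definition herm_prod :: "complex^'n \<Rightarrow> complex^'n \<Rightarrow> complex" where
  "herm_prod v w = (\<Sum>i\<in>UNIV. cnj (v$i) * w$i)"

definition Ck_eigendecomposition ::
  "nat \<Rightarrow> (real \<Rightarrow> complex^'n^'n) \<Rightarrow> (real \<Rightarrow> complex^'n^'n) \<Rightarrow> (real \<Rightarrow> complex^'n) \<Rightarrow> bool" where
  "Ck_eigendecomposition k B V l \<longleftrightarrow>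
     Ck_on k V UNIV \<and> Ck_on k (\<lambda>t. diag_mat (l t)) UNIV \<and>
     (\<forall>t. invertible (V t) \<and> B t = V t ** diag_mat (l t) ** matrix_inv (V t))"

definition transport_mat :: "(real \<Rightarrow> complex^'n^'n) \<Rightarrow> real \<Rightarrow> complex^'n^'n" where
  "transport_mat V t = matrix_inv (V t) ** vector_derivative V (at t)"

text \<open>
  The first condition says that each column of \<open>V\<close> has constant norm. It does not say that
  different columns have the same norm.
\<close>

definition parallel_transport_eigendecomposition ::
  "nat \<Rightarrow> (real \<Rightarrow> complex^'n^'n) \<Rightarrow> (real \<Rightarrow> complex^'n^'n) \<Rightarrow> (real \<Rightarrow> complex^'n) \<Rightarrow> bool" where
  "parallel_transport_eigendecomposition k B V l \<longleftrightarrow>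
     Ck_eigendecomposition k B V l \<and>
     (\<forall>j t. Re (herm_prod (column j (V t)) (column j (V t)) * transport_mat V t $ j $ j) =
              - (\<Sum>m\<in>UNIV - {j}.
                   Re (herm_prod (column j (V t)) (column m (V t)) * transport_mat V t $ m $ j)) \<and>
            Im (transport_mat V t $ j $ j) = 0)"

end

theory Submission
  imports Defs "HOL-Complex_Analysis.Riemann_Mapping"
begin

text \<open>
  Shrinking \<open>\<gamma>\<close> radially towards the cuspidal point and linearising there shows that the
  discriminant has winding number \<open>\<plusminus>1\<close> about \<open>0\<close> along \<open>\<gamma>\<close>. It equals
  \<open>(\<lambda>\<^sub>1 - \<lambda>\<^sub>2)\<^sup>2\<close>, so its continuous square root \<open>\<lambda>\<^sub>1 - \<lambda>\<^sub>2\<close> changes sign over one period,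
  while the trace \<open>\<lambda>\<^sub>1 + \<lambda>\<^sub>2\<close> does not: the eigenvalues are exchanged. Hence
  \<open>v\<^sub>1(t + 1) = c(t) v\<^sub>2(t)\<close> and \<open>v\<^sub>2(t + 1) = d(t) v\<^sub>1(t)\<close>. The column norms are constant, which fixes
  the moduli of \<open>c\<close> and \<open>d\<close>; the logarithmic derivatives of \<open>c\<close>, \<open>d\<close> and \<open>det V\<close> are real because
  the diagonal of \<open>V\<^sup>-\<^sup>1 V'\<close> is, which fixes the arguments. Constancy of the argument of \<open>det V\<close> gives \<open>c d < 0\<close>.
\<close>

section \<open>Winding numbers at a nondegenerate zero\<close>

text \<open>If \<open>q\<close> is a continuous logarithm of \<open>p\<close>, then
  \<open>2 * q\<close> is one of the square, and a winding number is the increment of such a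
  logarithm divided by 2 pi i.\<close>

lemma winding_number_power2:
  assumes "path p" "0 \<notin> path_image p"
  shows "winding_number (\<lambda>t. p t ^ 2) 0 = 2 * winding_number p 0"
proof -
  obtain q where q: "path q" "pathfinish q - pathstart q = 2 * of_real pi * \<i> * winding_number p 0"
    "\<And>t. t \<in> {0..1} \<Longrightarrow> p t = 0 + exp (q t)"
    using winding_number_as_continuous_log[OF assms] by blast
  have "winding_number (\<lambda>t. p t ^ 2) 0 = winding_number (exp \<circ> (\<lambda>t. 2 * q t)) 0"
    by (rule winding_number_cong) (simp add: q(3) exp_double)
  also have "path (\<lambda>t. 2 * q t)"
    using q(1) unfolding path_def by (intro continuous_intros)
  then have "winding_number (exp \<circ> (\<lambda>t. 2 * q t)) 0 = 2 * winding_number p 0"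
    using q(2) by (simp add: winding_number_compose_exp pathstart_def pathfinish_def field_simps)
  finally show ?thesis .
qed

text \<open>Adding the constant \<open>Ln a\<close> to a continuous logarithm leaves its increment
  unchanged.\<close>

lemma winding_number_mult_const:
  assumes "path p" "0 \<notin> path_image p" "a \<noteq> 0"
  shows "winding_number (\<lambda>t. a * p t) 0 = winding_number p 0"
proof -
  obtain q where q: "path q" "pathfinish q - pathstart q = 2 * of_real pi * \<i> * winding_number p 0"
    "\<And>t. t \<in> {0..1} \<Longrightarrow> p t = 0 + exp (q t)"
    using winding_number_as_continuous_log[OF assms(1,2)] by blast
  have "winding_number (\<lambda>t. a * p t) 0 = winding_number (exp \<circ> (\<lambda>t. Ln a + q t)) 0"
    by (rule winding_number_cong) (simp add: q(3) exp_add \<open>a \<noteq> 0\<close>)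
  also have "path (\<lambda>t. Ln a + q t)"
    using q(1) unfolding path_def by (intro continuous_intros)
  then have "winding_number (exp \<circ> (\<lambda>t. Ln a + q t)) 0 = winding_number p 0"
    using q(2) by (simp add: winding_number_compose_exp pathstart_def pathfinish_def field_simps)
  finally show ?thesis .
qed

text \<open>As a real-linear map of the plane it has determinant
  \<open>norm \<alpha> ^ 2 - norm \<beta> ^ 2\<close>; for equal moduli a kernel vector is
  exhibited.\<close>

lemma inj_real_linear_complex_norm_neq:
  fixes \<alpha> \<beta> :: complex
  assumes "inj (\<lambda>z. \<alpha> * z + \<beta> * cnj z)"
  shows "norm \<alpha> \<noteq> norm \<beta>"
proof
  assume eq: "norm \<alpha> = norm \<beta>"
  have "\<exists>u. u \<noteq> 0 \<and> \<alpha> * u + \<beta> * cnj u = 0"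
  proof (cases "\<alpha> = 0")
    case True
    with eq show ?thesis by (auto intro: exI[of _ 1])
  next
    case False
    \<comment> \<open>For unimodular \<open>u\<close> the conjugate is the inverse, so the kernel
      equation turns into \<open>\<alpha> * u ^ 2 = - \<beta>\<close>.\<close>
    define u where "u = csqrt (- \<beta> / \<alpha>)"
    have u2: "u ^ 2 = - \<beta> / \<alpha>"
      by (simp add: u_def)
    have "norm u ^ 2 = 1"
      using eq False u2 by (metis divide_self norm_divide norm_minus_cancel norm_power norm_eq_zero)
    then have cu: "u * cnj u = 1"
      by (metis complex_norm_square of_real_1)
    then have "u \<noteq> 0" by auto
    moreover have "u * (\<alpha> * u + \<beta> * cnj u) = \<alpha> * u ^ 2 + \<beta> * (u * cnj u)"
      by (simp add: algebra_simps power2_eq_square)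
    then have "u * (\<alpha> * u + \<beta> * cnj u) = 0"
      using False by (simp add: u2 cu)
    ultimately show ?thesis by auto
  qed
  then obtain u where "u \<noteq> 0" "\<alpha> * u + \<beta> * cnj u = 0" by blast
  with injD[OF assms, of u 0] show False by simp
qed

text \<open>The coefficients are the Wirtinger derivatives of \<open>L\<close>, found by writing
  \<open>Re z\<close> and \<open>Im z\<close> through \<open>z\<close> and
  \<open>cnj z\<close>.\<close>

lemma real_linear_complex_decomp:
  fixes L :: "complex \<Rightarrow> complex"
  assumes "linear L"
  obtains \<alpha> \<beta> where "L = (\<lambda>z. \<alpha> * z + \<beta> * cnj z)"
proof
  have eq: "L z = Re z *\<^sub>R L 1 + Im z *\<^sub>R L \<i>" for z
  proof -
    have "L (Re z *\<^sub>R 1 + Im z *\<^sub>R \<i>) = Re z *\<^sub>R L 1 + Im z *\<^sub>R L \<i>"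
      using assms by (simp add: linear_add linear_cmul)
    moreover have "Re z *\<^sub>R 1 + Im z *\<^sub>R \<i> = z"
      by (simp add: complex_eq_iff)
    ultimately show ?thesis by simp
  qed
  show "L = (\<lambda>z. (L 1 - \<i> * L \<i>) / 2 * z + (L 1 + \<i> * L \<i>) / 2 * cnj z)"
  proof
    show "L z = (L 1 - \<i> * L \<i>) / 2 * z + (L 1 + \<i> * L \<i>) / 2 * cnj z" for z
      unfolding eq[of z] by (simp add: complex_eq_iff field_simps)
  qed
qed

text \<open>By injectivity one of the terms \<open>\<alpha> * z\<close> and
  \<open>\<beta> * cnj z\<close> strictly dominates, so the image loop deforms to it within the
  punctured plane; the dominant term decides whether orientation is kept or reversed. The winding
  number of a closed path is an integer, so the second value is just its negative.\<close>

lemma winding_number_inj_linear: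
  fixes L :: "complex \<Rightarrow> complex"
  assumes "linear L" "inj L" "path p" "pathfinish p = pathstart p" "0 \<notin> path_image p"
  shows "winding_number (L \<circ> p) 0 \<in> {winding_number p 0, - cnj (winding_number p 0)}"
proof -
  obtain \<alpha> \<beta> where L: "L = (\<lambda>z. \<alpha> * z + \<beta> * cnj z)"
    using real_linear_complex_decomp[OF assms(1)] .
  have neq: "norm \<alpha> \<noteq> norm \<beta>"
    using inj_real_linear_complex_norm_neq assms(2) unfolding L by blast
  have nz: "p t \<noteq> 0" if "t \<in> {0..1}" for t
    using assms(5) that by (auto simp: path_image_def)
  have cp: "continuous_on {0..1} p" using assms(3) by (simp add: path_def)
  have ends: "p 1 = p 0" using assms(4) by (simp add: pathfinish_def pathstart_def)
  have path_Lp: "path (L \<circ> p)"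
    unfolding L path_def o_def by (intro continuous_intros cp)
  have cnj_p: "winding_number (cnj \<circ> p) 0 = - cnj (winding_number p 0)"
    using winding_number_cnj[OF assms(3,5)] by simp
  show ?thesis
  proof (cases "norm \<beta> < norm \<alpha>")
    case True
    have hom: "homotopic_loops (- {0}) (\<lambda>t. \<alpha> * p t) (L \<circ> p)"
    proof (rule homotopic_loops_nearby_explicit)
      show "path (\<lambda>t. \<alpha> * p t)"
        unfolding path_def by (intro continuous_intros cp)
      show "norm ((L \<circ> p) t - \<alpha> * p t) < norm (\<alpha> * p t - x)"
        if "t \<in> {0..1}" "x \<notin> - {0}" for t x
        using True nz[OF that(1)] that(2) by (simp add: L norm_mult)
    qed (simp_all add: path_Lp ends pathfinish_def pathstart_def)
    have "winding_number (\<lambda>t. \<alpha> * p t) 0 = winding_number p 0"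
      using True by (intro winding_number_mult_const assms) auto
    then show ?thesis
      using winding_number_homotopic_loops[OF hom] by simp
  next
    case False
    with neq have lt: "norm \<alpha> < norm \<beta>" by simp
    have hom: "homotopic_loops (- {0}) (\<lambda>t. \<beta> * (cnj \<circ> p) t) (L \<circ> p)"
    proof (rule homotopic_loops_nearby_explicit)
      show "path (\<lambda>t. \<beta> * (cnj \<circ> p) t)"
        unfolding path_def o_def by (intro continuous_intros cp)
      show "norm ((L \<circ> p) t - \<beta> * (cnj \<circ> p) t) < norm (\<beta> * (cnj \<circ> p) t - x)"
        if "t \<in> {0..1}" "x \<notin> - {0}" for t x
        using lt nz[OF that(1)] that(2) by (simp add: L norm_mult)
    qed (simp_all add: path_Lp ends pathfinish_def pathstart_def)
    have "winding_number (\<lambda>t. \<beta> * (cnj \<circ> p) t) 0 = - cnj (winding_number p 0)"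
      unfolding cnj_p[symmetric]
    proof (rule winding_number_mult_const)
      show "path (cnj \<circ> p)"
        unfolding path_def o_def by (intro continuous_intros cp)
      show "0 \<notin> path_image (cnj \<circ> p)"
        using nz by (auto simp: path_image_def)
    qed (use lt in auto)
    then show ?thesis
      using winding_number_homotopic_loops[OF hom] by simp
  qed
qed

text \<open>The loop is contracted towards 0 inside \<open>S\<close>, where \<open>f\<close> has no
  other zero, until the derivative governs \<open>f\<close>; a Rouche-type estimate then replaces
  \<open>f\<close> by \<open>L\<close>.\<close>

lemma winding_number_compose_nondegenerate_zero:
  fixes f L :: "complex \<Rightarrow> complex"
  assumes "convex S" "0 \<in> S" "continuous_on S f"
    and "f 0 = 0" and nz: "\<And>z. z \<in> S - {0} \<Longrightarrow> f z \<noteq> 0"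
    and deriv: "(f has_derivative L) (at 0)" and "inj L"
    and p: "path p" "pathfinish p = pathstart p" "path_image p \<subseteq> S - {0}"
  shows "winding_number (f \<circ> p) 0 \<in> {winding_number p 0, - cnj (winding_number p 0)}"
proof -
  have "linear L" using deriv by (rule has_derivative_linear)
  obtain m where m: "m > 0" "\<And>z. m * norm z \<le> norm (L z)"
    using linear_inj_bounded_below_pos[OF \<open>linear L\<close> \<open>inj L\<close>] by blast
  \<comment> \<open>Half of the lower bound \<open>m\<close> makes the error strictly smaller than
    \<open>norm (L z)\<close> for \<open>z \<noteq> 0\<close> near 0.\<close>
  obtain d where d: "d > 0" "\<And>z. norm z < d \<Longrightarrow> norm (f z - L z) \<le> m / 2 * norm z"
    using deriv m(1) \<open>f 0 = 0\<close> unfolding has_derivative_at_alt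
    by (auto dest!: spec[of _ "m / 2"])
  obtain B where B: "B > 0" "\<And>t. t \<in> {0..1} \<Longrightarrow> norm (p t) \<le> B"
    using bounded_path_image[OF p(1)] unfolding bounded_pos path_image_def by auto
  \<comment> \<open>As the loop has norm at most \<open>B\<close>, this factor brings it within
    \<open>d / 2\<close> of 0; being at most 1, it keeps the shrinking inside the convex
    set.\<close>
  define e where "e = min 1 (d / (2 * B))"
  have e: "0 < e" "e \<le> 1" using d B by (auto simp: e_def)
  have small: "norm (e *\<^sub>R p t) < d" if "t \<in> {0..1}" for t
  proof -
    have "norm (e *\<^sub>R p t) \<le> d / (2 * B) * B"
      unfolding norm_scaleR using B(2)[OF that] e B(1) d(1) by (intro mult_mono) (auto simp: e_def)
    also have "\<dots> < d" using B d by simp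
    finally show ?thesis .
  qed
  have pS: "p t \<in> S" "p t \<noteq> 0" if "t \<in> {0..1}" for t
    using p(3) that unfolding path_image_def by blast+
  have cp: "continuous_on {0..1} p" using p(1) by (simp add: path_def)
  have ends: "p 1 = p 0" using p(2) by (simp add: pathfinish_def pathstart_def)
  have path_e: "path (\<lambda>t. e *\<^sub>R p t)" "pathfinish (\<lambda>t. e *\<^sub>R p t) = pathstart (\<lambda>t. e *\<^sub>R p t)"
    using cp ends by (auto simp: path_def pathfinish_def pathstart_def intro!: continuous_intros)
  have hom1: "homotopic_loops (S - {0}) p (\<lambda>t. e *\<^sub>R p t)"
  proof (rule homotopic_loops_linear[OF p(1) path_e(1) p(2) path_e(2)])
    fix t :: real assume t: "t \<in> {0..1}"
    show "closed_segment (p t) (e *\<^sub>R p t) \<subseteq> S - {0}"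
    proof
      fix z assume "z \<in> closed_segment (p t) (e *\<^sub>R p t)"
      then obtain u where u: "0 \<le> u" "u \<le> 1" "z = (1 - u) *\<^sub>R p t + u *\<^sub>R e *\<^sub>R p t"
        by (auto simp: in_segment)
      \<comment> \<open>The segment is radial: its points are \<open>r *\<^sub>R p t\<close> with
        \<open>0 < r \<le> 1\<close>, hence lie between 0 and \<open>p t\<close> without reaching
        0.\<close>
      define r where "r = (1 - u) + u * e"
      have z: "z = r *\<^sub>R p t" using u(3) by (simp add: r_def algebra_simps)
      have "r > 0"
        using u(1,2) e by (cases "u = 0") (auto simp: r_def intro!: add_nonneg_pos mult_pos_pos)
      moreover have "r \<le> 1"
        using mult_left_mono[OF e(2) u(1)] by (simp add: r_def)
      ultimately have "z \<in> S"
        using convexD_alt[OF \<open>convex S\<close> \<open>0 \<in> S\<close> pS(1)[OF t], of r] z by simp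
      with \<open>r > 0\<close> pS[OF t] z show "z \<in> S - {0}" by auto
    qed
  qed
  have hom2: "homotopic_loops (- {0}) (f \<circ> p) (f \<circ> (\<lambda>t. e *\<^sub>R p t))"
    by (rule homotopic_loops_continuous_image[OF hom1])
      (use \<open>continuous_on S f\<close> nz in \<open>auto intro: continuous_on_subset\<close>)
  have pathf: "path (f \<circ> (\<lambda>t. e *\<^sub>R p t))"
    using homotopic_loops_imp_path[OF hom2] by blast
  have cL: "continuous_on UNIV L"
    using \<open>linear L\<close> linear_continuous_on linear_conv_bounded_linear by blast
  have hom3: "homotopic_loops (- {0}) (L \<circ> (\<lambda>t. e *\<^sub>R p t)) (f \<circ> (\<lambda>t. e *\<^sub>R p t))"
  proof (rule homotopic_loops_nearby_explicit)
    fix t :: real and x :: complex assume t: "t \<in> {0..1}" and x: "x \<notin> - {0}"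
    have "norm (f (e *\<^sub>R p t) - L (e *\<^sub>R p t)) \<le> m / 2 * norm (e *\<^sub>R p t)"
      by (rule d(2)[OF small[OF t]])
    also have "\<dots> < m * norm (e *\<^sub>R p t)"
      using m(1) e pS[OF t] by simp
    also have "\<dots> \<le> norm (L (e *\<^sub>R p t))" by (rule m(2))
    finally show "norm ((f \<circ> (\<lambda>t. e *\<^sub>R p t)) t - (L \<circ> (\<lambda>t. e *\<^sub>R p t)) t)
        < norm ((L \<circ> (\<lambda>t. e *\<^sub>R p t)) t - x)"
      using x by simp
  next
    show "path (L \<circ> (\<lambda>t. e *\<^sub>R p t))"
      using path_e(1) cL by (auto intro: path_continuous_image continuous_on_subset)
  qed (use pathf ends in \<open>auto simp: pathfinish_def pathstart_def\<close>)
  have "winding_number (f \<circ> p) 0 = winding_number (L \<circ> (\<lambda>t. e *\<^sub>R p t)) 0"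
    using winding_number_homotopic_loops[OF hom2] winding_number_homotopic_loops[OF hom3] by simp
  moreover have "winding_number (\<lambda>t. e *\<^sub>R p t) 0 = winding_number p 0"
    unfolding scaleR_conv_of_real using p e by (intro winding_number_mult_const) auto
  moreover have "winding_number (L \<circ> (\<lambda>t. e *\<^sub>R p t)) 0
      \<in> {winding_number (\<lambda>t. e *\<^sub>R p t) 0, - cnj (winding_number (\<lambda>t. e *\<^sub>R p t) 0)}"
    by (rule winding_number_inj_linear)
      (use \<open>linear L\<close> \<open>inj L\<close> path_e e pS in \<open>auto simp: path_image_def\<close>)
  ultimately show ?thesis by simp
qed

text \<open>Components of the complements correspond. Boundedness is not a topological property, but
  here the closure of a bounded component is compact and \<open>f\<close> is continuous on all of
  it.\<close>

lemma homeomorphism_image_inside: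
  fixes f :: "'a::euclidean_space \<Rightarrow> 'b::euclidean_space"
  assumes hom: "homeomorphism UNIV UNIV f g" and "x \<in> inside S"
  shows "f x \<in> inside (f ` S)"
proof -
  have x: "x \<in> - S" and bdd: "bounded (connected_component_set (- S) x)"
    using \<open>x \<in> inside S\<close> by (auto simp: inside_def)
  have "bij f"
    using hom unfolding homeomorphism_def by (metis UNIV_I bij_betw_def injI)
  have "homeomorphism (- S) (- f ` S) f g"
    by (rule homeomorphism_of_subsets[OF hom]) (use \<open>bij f\<close> in \<open>auto simp: bij_image_Compl_eq\<close>)
  then have "connected_component_set (- f ` S) (f x) = f ` connected_component_set (- S) x"
    by (rule connected_component_set_homeomorphism[OF _ x])
  moreover have "compact (f ` closure (connected_component_set (- S) x))"
    using hom bdd by (intro compact_continuous_image)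
      (auto simp: homeomorphism_def intro: continuous_on_subset)
  then have "bounded (f ` connected_component_set (- S) x)"
    by (meson bounded_subset closure_subset compact_imp_bounded image_mono)
  moreover have "f x \<notin> f ` S"
    using hom x unfolding homeomorphism_def by (metis ComplD UNIV_I imageE)
  ultimately show ?thesis
    by (simp add: inside_def)
qed

section \<open>The discriminant along a Jordan curve\<close>

lemma eig_disc_conv_trace_det: "eig_disc M = trace M ^ 2 - 4 * det M"
  by (simp add: eig_disc_def trace_def det_2 sum_2 power2_eq_square algebra_simps)

text \<open>A vanishing discriminant leaves half the trace as the only possible eigenvalue.\<close>

lemma distinct_eigenvals_imp_eig_disc_nonzero:
  assumes "distinct_eigenvals M"
  shows "eig_disc M \<noteq> 0"
proof
  assume disc: "eig_disc M = 0"
  have "\<mu> = trace M / 2" if "eigenval M \<mu>" for \<mu>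
  proof -
    from that obtain v where v: "v \<noteq> 0" "M *v v = \<mu> *s v"
      unfolding eigenval_def by auto
    have "(M - mat \<mu>) *v v = 0"
      using v(2) by (simp add: matrix_vector_mult_def vec_eq_iff forall_2 sum_2 mat_def algebra_simps)
    with v(1) have "\<not> invertible (M - mat \<mu>)"
      using matrix_left_invertible_ker[of "M - mat \<mu>"] by (auto simp: invertible_def)
    then have "det (M - mat \<mu>) = 0"
      using invertible_det_nz by blast
    \<comment> \<open>Completing the square: \<open>4 * det (M - mat \<mu>)\<close> is the left side
      minus the right side.\<close>
    then have "(2 * \<mu> - trace M) ^ 2 = eig_disc M"
      by (simp add: det_2 mat_def eig_disc_def trace_def sum_2 power2_eq_square) algebra
    with disc show ?thesis by (simp add: field_simps)
  qed
  then have "card {\<mu>. eigenval M \<mu>} \<le> card {trace M / 2}"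
    by (intro card_mono) auto
  with assms show False
    by (simp add: distinct_eigenvals_def)
qed

text \<open>In a complex coordinate centred at \<open>\<xi>0\<close> the discriminant has a single,
  nondegenerate zero, and a Jordan curve winds \<plusminus>1 times around a point inside it. The
  orientation of \<open>\<gamma>\<close> and the sign of the Jacobian determinant are unknown, so
  only the norm is determined.\<close>

lemma norm_winding_number_eig_disc:
  fixes A :: "real^2 \<Rightarrow> complex^2^2" and \<gamma> :: "real \<Rightarrow> real^2"
  assumes "convex \<Omega>" "continuous_on \<Omega> A" "generic_cuspidal_point \<Omega> A \<xi>0"
    and dist: "\<And>\<xi>. \<xi> \<in> \<Omega> - {\<xi>0} \<Longrightarrow> distinct_eigenvals (A \<xi>)"
    and "simple_path \<gamma>" "path_image \<gamma> \<subseteq> \<Omega>" and ins: "\<xi>0 \<in> inside (path_image \<gamma>)"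
  shows "norm (winding_number (\<lambda>t. eig_disc (A (\<gamma> t))) 0) = 1"
proof -
  define \<phi> :: "real^2 \<Rightarrow> complex" where "\<phi> = (\<lambda>x. of_real (x $ 1) + \<i> * of_real (x $ 2))"
  define \<psi> :: "complex \<Rightarrow> real^2" where "\<psi> = (\<lambda>z. Re z *\<^sub>R axis 1 1 + Im z *\<^sub>R axis 2 1)"
  have \<psi>\<phi>: "\<psi> (\<phi> x) = x" and \<phi>\<psi>: "\<phi> (\<psi> z) = z" for x z
    by (simp_all add: \<phi>_def \<psi>_def vec_eq_iff forall_2 axis_def complex_eq_iff)
  have lin: "linear \<phi>" "linear \<psi>"
    by (auto intro!: linearI simp: \<phi>_def \<psi>_def algebra_simps complex_eq_iff)
  then have blin: "bounded_linear \<phi>" "bounded_linear \<psi>"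
    by (simp_all add: linear_conv_bounded_linear)
  have cont: "continuous_on U \<phi>" "continuous_on W \<psi>" for U W
    using blin by (auto intro: linear_continuous_on)
  define p where "p = (\<lambda>t. \<phi> (\<gamma> t - \<xi>0))"
  define f where "f = (\<lambda>z. eig_disc (A (\<xi>0 + \<psi> z)))"
  define S where "S = {z. \<xi>0 + \<psi> z \<in> \<Omega>}"
  let ?J = "\<lambda>x. jacobian (disc_map A) (at \<xi>0) *v x"
  \<comment> \<open>Under the identification \<open>\<phi>\<close> of the two planes
    \<open>disc_map\<close> is the discriminant itself, so the Jacobian at \<open>\<xi>0\<close>
    becomes the derivative of \<open>f\<close> at 0.\<close>
  have f_alt: "f z = \<phi> (disc_map A (\<xi>0 + \<psi> z))" for z
    by (simp add: f_def \<phi>_def disc_map_def complex_eq_iff)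
  have deriv: "(disc_map A has_derivative ?J) (at \<xi>0)" and "inj ?J"
    using assms(3) jacobian_works inj_matrix_vector_mult
    by (auto simp: generic_cuspidal_point_def)
  have "((\<lambda>z. \<phi> (disc_map A (\<xi>0 + \<psi> z))) has_derivative (\<lambda>z. \<phi> (?J (\<psi> z)))) (at 0)"
  proof (intro bounded_linear.has_derivative[OF blin(1)] has_derivative_compose[of _ \<psi> 0 UNIV "disc_map A"])
    show "((\<lambda>z. \<xi>0 + \<psi> z) has_derivative \<psi>) (at 0)"
      using has_derivative_add[OF has_derivative_const bounded_linear_imp_has_derivative[OF blin(2)]] by simp
    show "(disc_map A has_derivative ?J) (at (\<xi>0 + \<psi> 0))"
      using deriv linear_0[OF lin(2)] by simp
  qed
  then have derivf: "(f has_derivative (\<lambda>z. \<phi> (?J (\<psi> z)))) (at 0)"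
    unfolding f_alt[symmetric] .
  have injL: "inj (\<lambda>z. \<phi> (?J (\<psi> z)))"
    using \<open>inj ?J\<close> by (smt (verit, best) \<psi>\<phi> \<phi>\<psi> inj_def)
  have contf: "continuous_on S f"
    unfolding f_def eig_disc_def
    by (intro continuous_intros continuous_on_compose2[OF assms(2)] cont) (auto simp: S_def)
  have convS: "convex S"
  proof -
    have "S = \<psi> -` ((\<lambda>x. - \<xi>0 + x) ` \<Omega>)"
      by (force simp: S_def)
    then show ?thesis
      using convex_linear_vimage[OF lin(2) convex_translation[OF assms(1), of "- \<xi>0"]] by metis
  qed
  have hom: "homeomorphism UNIV UNIV (\<lambda>x. \<phi> (x - \<xi>0)) (\<lambda>z. \<xi>0 + \<psi> z)"
    unfolding homeomorphism_def
  proof (intro conjI ballI)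
    show "range (\<lambda>x. \<phi> (x - \<xi>0)) = UNIV"
      by (rule surjI[of _ "\<lambda>z. \<xi>0 + \<psi> z"]) (simp add: \<phi>\<psi>)
    show "range (\<lambda>z. \<xi>0 + \<psi> z) = UNIV"
      by (rule surjI[of _ "\<lambda>x. \<phi> (x - \<xi>0)"]) (simp add: \<psi>\<phi>)
  qed (auto simp: \<psi>\<phi> \<phi>\<psi> intro!: continuous_intros continuous_on_compose2[OF cont(1)] cont)
  have im: "path_image p = (\<lambda>x. \<phi> (x - \<xi>0)) ` path_image \<gamma>"
    by (auto simp: p_def path_image_def)
  have "inj (\<lambda>x. \<phi> (x - \<xi>0))"
    by (rule inj_on_inverseI[of _ "\<lambda>z. \<xi>0 + \<psi> z"]) (simp add: \<psi>\<phi>)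
  then have simple: "simple_path p"
    using simple_path_continuous_image[OF \<open>simple_path \<gamma>\<close>, of "\<lambda>x. \<phi> (x - \<xi>0)"] hom
    by (auto simp: p_def o_def homeomorphism_def intro: continuous_on_subset inj_on_subset)
  have "(\<lambda>x. \<phi> (x - \<xi>0)) \<xi>0 \<in> inside (path_image p)"
    unfolding im by (rule homeomorphism_image_inside[OF hom ins])
  then have ins0: "0 \<in> inside (path_image p)"
    using linear_0[OF lin(1)] by simp
  \<comment> \<open>A simple path that is not closed has empty inside, so a point inside forces
    closedness.\<close>
  then have "0 \<notin> path_image p" and "pathfinish p = pathstart p"
    using simple inside_simple_curve_imp_closed by (auto simp: inside_def)
  have "path_image p \<subseteq> S - {0}"
    using assms(6) \<open>0 \<notin> path_image p\<close> unfolding im by (auto simp: S_def \<psi>\<phi>)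
  have "winding_number (f \<circ> p) 0 \<in> {winding_number p 0, - cnj (winding_number p 0)}"
  proof (rule winding_number_compose_nondegenerate_zero[OF convS _ contf _ _ derivf injL])
    show "0 \<in> S"
      using assms(3) linear_0[OF lin(2)] by (simp add: S_def generic_cuspidal_point_def)
    show "f 0 = 0"
      using assms(3) linear_0[OF lin(2)] linear_0[OF lin(1)]
      by (simp add: f_alt generic_cuspidal_point_def)
    fix z assume z: "z \<in> S - {0}"
    then have "\<psi> z \<noteq> 0"
      using \<phi>\<psi>[of z] linear_0[OF lin(1)] by auto
    with z show "f z \<noteq> 0"
      unfolding f_def by (intro distinct_eigenvals_imp_eig_disc_nonzero dist) (simp add: S_def)
  qed (use simple simple_path_imp_path \<open>pathfinish p = pathstart p\<close> \<open>path_image p \<subseteq> S - {0}\<close> in auto)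
  moreover have "norm (winding_number p 0) = 1"
    by (rule simple_closed_path_norm_winding_number_inside[OF simple ins0])
  moreover have "f \<circ> p = (\<lambda>t. eig_disc (A (\<gamma> t)))"
    by (simp add: fun_eq_iff f_def p_def \<psi>\<phi>)
  ultimately show ?thesis by auto
qed

text \<open>If \<open>s\<close> closed up over one period, its winding number would be an integer
  and that of its square even, hence not of norm 1.\<close>

lemma sqrt_of_odd_winding_flips:
  fixes s :: "real \<Rightarrow> complex"
  assumes cont: "continuous_on UNIV s" and nz: "\<And>t. s t \<noteq> 0"
    and per: "\<And>t. s (t + 1) ^ 2 = s t ^ 2"
    and wn: "norm (winding_number (\<lambda>t. s t ^ 2) 0) = 1"
  shows "s (t + 1) = - s t"
proof -
  have path: "path s" and ni: "0 \<notin> path_image s"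
    using cont nz by (auto simp: path_def path_image_def intro: continuous_on_subset)
  have "s 1 \<noteq> s 0"
  proof
    assume "s 1 = s 0"
    then have "winding_number s 0 \<in> \<int>"
      using path ni by (intro integer_winding_number) (auto simp: pathfinish_def pathstart_def)
    then obtain n :: int where n: "winding_number s 0 = of_int n"
      by (auto elim: Ints_cases)
    then have "norm (of_int (2 * n) :: complex) = 1"
      using wn winding_number_power2[OF path ni] by (metis of_int_mult of_int_numeral)
    then have "\<bar>2 * n\<bar> = 1"
      by (metis norm_of_int of_int_abs of_int_1 of_int_eq_iff)
    then show False by presburger
  qed
  \<comment> \<open>This quotient is continuous with values in \<plusminus>1, hence constant, which
    carries the sign change from 0 to every \<open>t\<close>.\<close>
  define q where "q = (\<lambda>t. s (t + 1) / s t)"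
  have "q t \<in> {1, - 1}" for t
  proof -
    have "q t ^ 2 = 1" using per nz by (simp add: q_def power_divide)
    then show ?thesis by (simp add: power2_eq_1_iff)
  qed
  moreover have "continuous_on UNIV q"
    unfolding q_def by (intro continuous_intros continuous_on_compose2[OF cont] cont) (auto simp: nz)
  ultimately have "q constant_on UNIV"
    by (intro continuous_finite_range_constant) (auto intro: finite_subset[of _ "{1, - 1}"])
  then have "q t = q 0" by (auto simp: constant_on_def)
  moreover have "q 0 = - 1"
    using \<open>q 0 \<in> {1, - 1}\<close> \<open>s 1 \<noteq> s 0\<close> nz[of 0] by (auto simp: q_def)
  ultimately have "s (t + 1) / s t = - 1"
    by (simp add: q_def)
  then show ?thesis
    using nz[of t] by (simp add: divide_eq_eq split: if_splits)
qed

section \<open>Diagonalizations and constant arguments\<close>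

lemma diag_mat_mult_nth: "(diag_mat l ** M) $ i $ j = l $ i * M $ i $ j"
  by (simp add: diag_mat_def matrix_matrix_mult_def if_distrib[of "\<lambda>x. x * _"] cong: if_cong)

lemma mult_diag_mat_nth: "(M ** diag_mat l) $ i $ j = M $ i $ j * l $ j"
  by (simp add: diag_mat_def matrix_matrix_mult_def if_distrib[of "\<lambda>x. _ * x"] cong: if_cong)

lemma matrix_inv_mult_self:
  fixes V :: "'a::semiring_1^'n^'n"
  assumes "invertible V"
  shows "matrix_inv V ** V = mat 1" "V ** matrix_inv V = mat 1"
  using someI_ex[OF assms[unfolded invertible_def]] by (simp_all add: matrix_inv_def)

lemma trace_det_diagonalization:
  fixes V :: "complex^2^2"
  assumes "invertible V" and M: "M = V ** diag_mat l ** matrix_inv V"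
  shows "trace M = l $ 1 + l $ 2" "det M = l $ 1 * l $ 2"
proof -
  have inv: "matrix_inv V ** V = mat 1"
    by (rule matrix_inv_mult_self(1)[OF assms(1)])
  have "trace M = trace ((matrix_inv V ** V) ** diag_mat l)"
    unfolding M by (metis matrix_mul_assoc trace_mul_sym)
  then show "trace M = l $ 1 + l $ 2"
    unfolding inv by (simp add: trace_def sum_2 diag_mat_def)
  have "det M = det (matrix_inv V ** V) * det (diag_mat l)"
    unfolding M by (simp add: det_mul)
  then show "det M = l $ 1 * l $ 2"
    unfolding inv det_I by (simp add: det_2 diag_mat_def)
qed

lemma eig_disc_diagonalization:
  fixes V :: "complex^2^2"
  assumes "invertible V" "M = V ** diag_mat l ** matrix_inv V"
  shows "eig_disc M = (l $ 1 - l $ 2) ^ 2"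
  unfolding eig_disc_conv_trace_det trace_det_diagonalization[OF assms]
  by (simp add: power2_eq_square algebra_simps)

text \<open>The change of eigenbasis intertwines the two diagonal matrices. Its entry at
  \<open>i\<close>, \<open>j\<close> can therefore be nonzero only if
  \<open>l $ i = m $ j\<close>.\<close>

lemma diagonalizations_intertwine:
  fixes V W :: "complex^'n^'n"
  assumes "invertible V" "invertible W"
    and eq: "V ** diag_mat l ** matrix_inv V = W ** diag_mat m ** matrix_inv W"
  shows "l $ i * (matrix_inv V ** W) $ i $ j = (matrix_inv V ** W) $ i $ j * m $ j"
proof -
  have V: "matrix_inv V ** V = mat 1" and W: "matrix_inv W ** W = mat 1"
    using assms matrix_inv_mult_self(1) by auto
  have "diag_mat l ** (matrix_inv V ** W) = (matrix_inv V ** V) ** diag_mat l ** (matrix_inv V ** W)"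
    by (simp add: V)
  also have "\<dots> = matrix_inv V ** (V ** diag_mat l ** matrix_inv V) ** W"
    by (simp add: matrix_mul_assoc)
  also have "\<dots> = matrix_inv V ** W ** diag_mat m ** (matrix_inv W ** W)"
    by (simp add: eq matrix_mul_assoc)
  also have "\<dots> = (matrix_inv V ** W) ** diag_mat m"
    by (simp add: W)
  finally show ?thesis
    by (metis diag_mat_mult_nth mult_diag_mat_nth)
qed

text \<open>Formally the ratio is the exponential of the integral of \<open>r\<close>. Instead of
  integrating, the argument is shown to be constant, and positivity follows by continuity.\<close>

lemma positive_ratio_of_real_log_derivative:
  fixes f :: "real \<Rightarrow> complex" and r :: "real \<Rightarrow> real"
  assumes deriv: "\<And>t. (f has_vector_derivative of_real (r t) * f t) (at t)"
    and nz: "\<And>t. f t \<noteq> 0"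
  shows "\<exists>\<rho>>0. f t = of_real \<rho> * f 0"
proof -
  define g where "g = (\<lambda>t. f t / f 0)"
  have dg: "(g has_vector_derivative of_real (r t) * g t) (at t)" for t
    unfolding g_def using has_vector_derivative_divide[OF deriv] by (simp add: algebra_simps)
  have gnz: "g t \<noteq> 0" for t using nz by (simp add: g_def)
  have dcg: "((\<lambda>t. cnj (g t)) has_vector_derivative of_real (r t) * cnj (g t)) (at t)" for t
    using has_vector_derivative_cnj[OF dg[of t]] by simp
  define h where "h = (\<lambda>t. cnj (g t) / g t)" \<comment> \<open>constant iff the argument of \<open>g\<close> is constant mod \<open>\<pi>\<close>\<close>
  have "(h has_vector_derivative 0) (at t)" for t
  proof -
    \<comment> \<open>Since \<open>r\<close> is real, \<open>g\<close> and \<open>cnj g\<close>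
      satisfy the same linear equation; differentiating \<open>h * g = cnj g\<close> then leaves
      \<open>h' * g = 0\<close>.\<close>
    have "h differentiable (at t)"
      unfolding h_def using dg dcg gnz
      by (intro differentiable_divide) (auto intro: differentiableI_vector)
    then obtain h' where h': "(h has_vector_derivative h') (at t)"
      using vector_derivative_works by blast
    have "((\<lambda>t. h t * g t) has_vector_derivative h t * (of_real (r t) * g t) + h' * g t) (at t)"
      by (rule has_vector_derivative_mult[OF h' dg])
    moreover have "(\<lambda>t. h t * g t) = (\<lambda>t. cnj (g t))"
      using gnz by (simp add: h_def)
    ultimately have "h t * (of_real (r t) * g t) + h' * g t = of_real (r t) * cnj (g t)"
      using dcg vector_derivative_unique_at by metis
    moreover have "h t * g t = cnj (g t)"
      using gnz by (simp add: h_def)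
    then have "h t * (of_real (r t) * g t) = of_real (r t) * cnj (g t)"
      by (metis mult.left_commute)
    ultimately have "h' * g t = 0"
      by simp
    with gnz h' show ?thesis by auto
  qed
  then have "h t = h 0" for t
    by (metis UNIV_I convex_UNIV has_vector_derivative_zero_constant)
  moreover have "h 0 = 1" using nz by (simp add: h_def g_def)
  ultimately have "cnj (g t) = g t" for t
    using gnz[of t] by (simp add: h_def)
  then have real: "g t = of_real (Re (g t))" for t
    by (metis Reals_cnj_iff of_real_Re)
  have "continuous_on UNIV g"
    using dg by (blast intro: continuous_at_imp_continuous_on has_vector_derivative_continuous)
  then have "continuous_on UNIV (\<lambda>t. Re (g t))"
    by (intro continuous_intros)
  then have conn: "connected (range (\<lambda>t. Re (g t)))"
    by (intro connected_continuous_image) auto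
  have g0: "Re (g 0) = 1" using nz by (simp add: g_def)
  \<comment> \<open>\<open>g\<close> is real and never 0 with \<open>g 0 = 1\<close>, so the
    intermediate value theorem excludes a change of sign.\<close>
  have "Re (g t) > 0"
  proof (rule ccontr)
    assume "\<not> Re (g t) > 0"
    then have "0 \<in> range (\<lambda>t. Re (g t))"
      using g0 by (intro connectedD_interval[OF conn rangeI[of _ t] rangeI[of _ 0]]) simp_all
    then obtain u where "Re (g u) = 0" by auto
    with real[of u] gnz[of u] show False by simp
  qed
  moreover have "f t = of_real (Re (g t)) * f 0"
    using real[of t] nz[of 0] by (simp add: g_def)
  ultimately show ?thesis by blast
qed

section \<open>Parallel transport\<close>

lemma Re_herm_prod: "Re (herm_prod v w) = v \<bullet> w"
  by (simp add: herm_prod_def inner_vec_def inner_complex_def)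

lemma Ck_on_imp_continuous_on: "Ck_on k f S \<Longrightarrow> continuous_on S f"
  by (cases k) auto

lemma Ck_on_imp_differentiable: "Ck_on k f S \<Longrightarrow> k \<ge> 1 \<Longrightarrow> x \<in> S \<Longrightarrow> f differentiable (at x)"
  by (cases k) auto

lemma has_vector_derivative_transport_mat:
  fixes V :: "real \<Rightarrow> complex^'n^'n"
  assumes "invertible (V t)" "V differentiable (at t)"
  shows "(V has_vector_derivative V t ** transport_mat V t) (at t)"
  using assms
  by (simp add: transport_mat_def matrix_mul_assoc matrix_inv_mult_self vector_derivative_works)

lemma has_vector_derivative_nth:
  "(f has_vector_derivative f') F \<Longrightarrow> ((\<lambda>t. f t $ i) has_vector_derivative f' $ i) F"
  by (rule bounded_linear.has_vector_derivative[OF bounded_linear_vec_nth])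

text \<open>Column \<open>j\<close> of \<open>V' = V P\<close> is the combination of the columns of
  \<open>V\<close> with coefficients \<open>P $ m $ j\<close>, so the condition says that each
  column is orthogonal, in the real inner product, to its derivative.\<close>

lemma norm_column_parallel_transport_const:
  fixes V :: "real \<Rightarrow> complex^'n^'n"
  assumes inv: "\<And>t. invertible (V t)" and diff: "\<And>t. V differentiable (at t)"
    and par: "\<And>t. Re (herm_prod (column j (V t)) (column j (V t)) * transport_mat V t $ j $ j) =
      - (\<Sum>m\<in>UNIV - {j}. Re (herm_prod (column j (V t)) (column m (V t)) * transport_mat V t $ m $ j))"
  shows "norm (column j (V t)) = norm (column j (V 0))"
proof -
  let ?v = "\<lambda>t. column j (V t)"
  have "linear (column j :: complex^'n^'n \<Rightarrow> _)"
    by (auto intro!: linearI simp: column_def vec_eq_iff)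
  then have "bounded_linear (column j :: complex^'n^'n \<Rightarrow> _)"
    by (simp add: linear_conv_bounded_linear)
  then have dv: "(?v has_vector_derivative column j (V t ** transport_mat V t)) (at t)" for t
    by (rule bounded_linear.has_vector_derivative)
      (intro has_vector_derivative_transport_mat inv diff)
  have orth: "?v t \<bullet> column j (V t ** transport_mat V t) = 0" for t
  proof -
    have "herm_prod (?v t) (column j (V t ** transport_mat V t))
        = (\<Sum>m\<in>UNIV. herm_prod (?v t) (column m (V t)) * transport_mat V t $ m $ j)"
      unfolding herm_prod_def matrix_matrix_mult_def column_def
      by (simp add: sum_distrib_left sum_distrib_right mult.assoc) (rule sum.swap)
    then have "?v t \<bullet> column j (V t ** transport_mat V t)
        = (\<Sum>m\<in>UNIV. Re (herm_prod (?v t) (column m (V t)) * transport_mat V t $ m $ j))"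
      by (simp flip: Re_herm_prod)
    also have "\<dots> = 0"
      using par[of t] by (simp add: sum.remove[of UNIV j])
    finally show ?thesis .
  qed
  have "((\<lambda>t. ?v t \<bullet> ?v t) has_vector_derivative 0) (at t)" for t
    using bounded_bilinear.has_vector_derivative[OF bounded_bilinear_inner dv dv, of t]
    by (simp add: orth inner_commute[of _ "?v t"])
  then obtain a where "?v t \<bullet> ?v t = a" for t
    using has_vector_derivative_zero_constant[OF convex_UNIV, of "\<lambda>t. ?v t \<bullet> ?v t"] by auto
  then show ?thesis
    by (simp add: norm_eq_sqrt_inner)
qed

text \<open>Differentiate \<open>v_i (t + 1) = c t * v_j t\<close>, expand both sides in the basis
  of columns at \<open>t\<close>, and compare the coefficients of \<open>v_j\<close>. Keeping
  \<open>i\<close> and \<open>j\<close> general serves both coefficients.\<close>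

lemma column_swap_coefficient_derivative:
  fixes V :: "real \<Rightarrow> complex^2^2" and c d :: "real \<Rightarrow> complex" and i j :: 2
  assumes "i \<noteq> j"
    and inv: "\<And>t. invertible (V t)" and diff: "\<And>t. V differentiable (at t)"
    and c: "\<And>t r. V (t + 1) $ r $ i = V t $ r $ j * c t"
    and d: "\<And>t r. V (t + 1) $ r $ j = V t $ r $ i * d t"
  shows "(c has_vector_derivative
    (transport_mat V (t + 1) $ i $ i - transport_mat V t $ j $ j) * c t) (at t)"
proof -
  let ?P = "transport_mat V"
  \<comment> \<open>Up to a sign depending on the order of \<open>i\<close> and \<open>j\<close>,
    this is \<open>det (V t)\<close>, hence nonzero.\<close>
  let ?W = "\<lambda>t. V t $ 1 $ j * V t $ 2 $ i - V t $ 2 $ j * V t $ 1 $ i"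
  have UNIV_ij: "(UNIV :: 2 set) = {i, j}"
    using assms(1) exhaust_2[of i] exhaust_2[of j] by (auto simp: UNIV_2)
  have dV: "((\<lambda>t. V t $ r $ m) has_vector_derivative
      V t $ r $ i * ?P t $ i $ m + V t $ r $ j * ?P t $ j $ m) (at t)" for r m t
  proof -
    have "((\<lambda>t. V t $ r $ m) has_vector_derivative (V t ** ?P t) $ r $ m) (at t)"
      by (intro has_vector_derivative_nth has_vector_derivative_transport_mat inv diff)
    then show ?thesis
      using assms(1) by (simp add: matrix_matrix_mult_def UNIV_ij)
  qed
  have dV1: "((\<lambda>t. V (t + 1) $ r $ m) has_vector_derivative
      V (t + 1) $ r $ i * ?P (t + 1) $ i $ m + V (t + 1) $ r $ j * ?P (t + 1) $ j $ m) (at t)" for r m t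
    using vector_diff_chain_at[of "\<lambda>t. t + 1" 1 t, OF _ dV[of r m "t + 1"]]
    by (simp add: o_def has_vector_derivative_add_const)
  have W: "?W t \<noteq> 0" for t
  proof -
    have "det (V t) \<noteq> 0" using inv invertible_det_nz by blast
    then show ?thesis
      using assms(1) exhaust_2[of i] exhaust_2[of j] by (auto simp: det_2 algebra_simps)
  qed
  \<comment> \<open>Cramer's rule expresses \<open>c\<close> through entries of \<open>V\<close>, hence it is differentiable.\<close>
  have cW: "c = (\<lambda>t. (V (t + 1) $ 1 $ i * V t $ 2 $ i - V (t + 1) $ 2 $ i * V t $ 1 $ i) / ?W t)"
    using W by (simp add: fun_eq_iff c nonzero_eq_divide_eq algebra_simps)
  have "c differentiable (at t)"
    unfolding cW by (intro differentiable_divide differentiable_diff differentiable_mult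
        differentiableI_vector[OF dV] differentiableI_vector[OF dV1] W)
  then obtain c' where c': "(c has_vector_derivative c') (at t)"
    using vector_derivative_works by blast
  have key: "V t $ r $ j * (?P (t + 1) $ i $ i * c t - c' - c t * ?P t $ j $ j)
      + V t $ r $ i * (?P (t + 1) $ j $ i * d t - c t * ?P t $ i $ j) = 0" for r
  proof -
    have "((\<lambda>t. V (t + 1) $ r $ i) has_vector_derivative V t $ r $ j * c' +
        (V t $ r $ i * ?P t $ i $ j + V t $ r $ j * ?P t $ j $ j) * c t) (at t)"
      unfolding c by (rule has_vector_derivative_mult[OF dV c'])
    from vector_derivative_unique_at[OF this dV1, unfolded c d] show ?thesis
      by (simp add: algebra_simps)
  qed
  \<comment> \<open>These are the coefficients of a vanishing combination of the independent columns
    \<open>j\<close> and \<open>i\<close>; eliminating \<open>Y\<close> leaves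
    \<open>?W t * X = 0\<close>.\<close>
  define X Y where "X = ?P (t + 1) $ i $ i * c t - c' - c t * ?P t $ j $ j"
    and "Y = ?P (t + 1) $ j $ i * d t - c t * ?P t $ i $ j"
  have "?W t * X = (V t $ 1 $ j * X + V t $ 1 $ i * Y) * V t $ 2 $ i
      - (V t $ 2 $ j * X + V t $ 2 $ i * Y) * V t $ 1 $ i"
    by (simp add: algebra_simps)
  also have "\<dots> = 0"
    using key unfolding X_def Y_def by simp
  finally have "X = 0"
    using W[of t] by simp
  then have "c' = (?P (t + 1) $ i $ i - ?P t $ j $ j) * c t"
    by (simp add: X_def algebra_simps)
  with c' show ?thesis by simp
qed

text \<open>Liouville's formula for the linear system \<open>V' = V P\<close>.\<close>

lemma has_vector_derivative_det_transport:
  fixes V :: "real \<Rightarrow> complex^2^2"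
  assumes inv: "\<And>t. invertible (V t)" and diff: "\<And>t. V differentiable (at t)"
  shows "((\<lambda>t. det (V t)) has_vector_derivative trace (transport_mat V t) * det (V t)) (at t)"
proof -
  let ?P = "transport_mat V"
  have dV: "((\<lambda>t. V t $ r $ m) has_vector_derivative
      V t $ r $ 1 * ?P t $ 1 $ m + V t $ r $ 2 * ?P t $ 2 $ m) (at t)" for r m
  proof -
    have "((\<lambda>t. V t $ r $ m) has_vector_derivative (V t ** ?P t) $ r $ m) (at t)"
      by (intro has_vector_derivative_nth has_vector_derivative_transport_mat inv diff)
    then show ?thesis
      by (simp add: matrix_matrix_mult_def sum_2)
  qed
  let ?D = "V t $ 1 $ 1 * (V t $ 2 $ 1 * ?P t $ 1 $ 2 + V t $ 2 $ 2 * ?P t $ 2 $ 2)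
    + (V t $ 1 $ 1 * ?P t $ 1 $ 1 + V t $ 1 $ 2 * ?P t $ 2 $ 1) * V t $ 2 $ 2
    - (V t $ 1 $ 2 * (V t $ 2 $ 1 * ?P t $ 1 $ 1 + V t $ 2 $ 2 * ?P t $ 2 $ 1)
    + (V t $ 1 $ 1 * ?P t $ 1 $ 2 + V t $ 1 $ 2 * ?P t $ 2 $ 2) * V t $ 2 $ 1)"
  have "((\<lambda>t. det (V t)) has_vector_derivative ?D) (at t)"
    unfolding det_2 by (intro has_vector_derivative_diff has_vector_derivative_mult dV)
  moreover have "?D = trace (?P t) * det (V t)"
    by (simp add: det_2 trace_def sum_2 algebra_simps)
  ultimately show ?thesis by simp
qed

section \<open>Monodromy of the eigendecomposition\<close>

text \<open>\<open>path_image\<close> covers one period, whereas encircling refers to the whole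
  range; passing to fractional parts identifies them.\<close>

lemma smooth_Jordan_curve_path_image:
  assumes "smooth_Jordan_curve \<gamma>"
  shows "path_image \<gamma> = range \<gamma>"
proof -
  have per: "\<gamma> (t + 1) = \<gamma> t" for t
    using assms by (simp add: smooth_Jordan_curve_def periodic_with_def)
  have int: "\<gamma> (t + of_int n) = \<gamma> t" for t n
  proof (induction n rule: int_induct[of _ 0])
    case (step1 n)
    then show ?case using per[of "t + of_int n"] by (simp add: algebra_simps)
  next
    case (step2 n)
    then show ?case using per[of "t + of_int n - 1"] by (simp add: algebra_simps)
  qed simp
  have "\<gamma> t \<in> \<gamma> ` {0..1}" for t
  proof (rule image_eqI)
    show "\<gamma> t = \<gamma> (frac t)"
      using int[of "frac t" "\<lfloor>t\<rfloor>"] by (simp add: frac_def)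
    show "frac t \<in> {0..1}"
      using frac_ge_0[of t] frac_lt_1[of t] by simp
  qed
  then show ?thesis by (auto simp: path_image_def)
qed

lemma smooth_Jordan_curve_simple_path:
  assumes "smooth_Jordan_curve \<gamma>"
  shows "simple_path \<gamma>"
proof -
  have inj: "inj_on \<gamma> {0..<1}" and "\<gamma> (0 + 1) = \<gamma> 0"
    using assms unfolding smooth_Jordan_curve_def periodic_with_def by blast+
  then have end1: "\<gamma> 1 = \<gamma> 0" by simp
  have "x = y \<or> x = 0 \<and> y = 1 \<or> x = 1 \<and> y = 0"
    if xy: "x \<in> {0..1}" "y \<in> {0..1}" "\<gamma> x = \<gamma> y" for x y
  proof -
    have "x \<in> {0..<1} \<or> x = 1" "y \<in> {0..<1} \<or> y = 1"
      using xy(1,2) by auto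
    moreover have "x = y" if "x \<in> {0..<1}" "y \<in> {0..<1}"
      using inj_onD[OF inj xy(3)] that by blast
    moreover have "x = 0" if "x \<in> {0..<1}" "y = 1"
      using inj_onD[OF inj, of x 0] that xy(3) end1 by simp
    moreover have "y = 0" if "y \<in> {0..<1}" "x = 1"
      using inj_onD[OF inj, of y 0] that xy(3) end1 by simp
    ultimately show ?thesis by blast
  qed
  moreover have "continuous_on {0..1} \<gamma>"
    using assms by (auto simp: smooth_Jordan_curve_def
        intro: C1_differentiable_imp_continuous_on C1_differentiable_on_subset)
  ultimately show ?thesis
    unfolding simple_path_def loop_free_def path_def by blast
qed

text \<open>Parallel transport fixes each column norm but not their ratio: rescaling one column by a
  positive constant preserves all conditions. The ratio therefore enters the swap matrix, and it
  disappears when the two norms agree.\<close>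

theorem theorem2p13:
  fixes k :: nat and \<Omega> :: "(real^2) set" and A :: "real^2 \<Rightarrow> complex^2^2"
    and \<xi>0 :: "real^2" and \<gamma> :: "real \<Rightarrow> real^2"
    and V :: "real \<Rightarrow> complex^2^2" and l :: "real \<Rightarrow> complex^2"
  assumes "k \<ge> 1"
    and "open \<Omega>" and "convex \<Omega>"
    and "Ck_on k A \<Omega>"
    and "generic_cuspidal_point \<Omega> A \<xi>0"
    and "\<And>\<xi>. \<xi> \<in> \<Omega> - {\<xi>0} \<Longrightarrow> distinct_eigenvals (A \<xi>)"
    and "smooth_Jordan_curve \<gamma>" and "range \<gamma> \<subseteq> \<Omega>" and "encircles \<gamma> \<xi>0"
    and "periodic_with 1 (\<lambda>t. A (\<gamma> t))"
    and "parallel_transport_eigendecomposition k (\<lambda>t. A (\<gamma> t)) V l"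
  shows "\<exists>\<alpha>1 \<alpha>2 :: real.
    [\<alpha>1 + \<alpha>2 = pi] (rmod (2 * pi)) \<and>
    (\<forall>t. l (t + 1) $ 1 = l t $ 2 \<and> l (t + 1) $ 2 = l t $ 1) \<and>
    (norm (column 1 (V 0)) = norm (column 2 (V 0)) \<longrightarrow>
      (\<forall>t. matrix_inv (V t) ** V (t + 1) =
        vector [vector [0, exp (\<i> * of_real \<alpha>2)],
                vector [exp (\<i> * of_real \<alpha>1), 0]])) \<and>
    (\<forall>t. matrix_inv (V t) ** V (t + 1) =
      vector [vector [0, of_real (norm (column 2 (V 0)) / norm (column 1 (V 0))) * exp (\<i> * of_real \<alpha>2)],
              vector [of_real (norm (column 1 (V 0)) / norm (column 2 (V 0))) * exp (\<i> * of_real \<alpha>1), 0]])"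
proof -
  let ?P = "transport_mat V" and ?N = "\<lambda>j. norm (column j (V 0))"
  have contA: "continuous_on \<Omega> A"
    using assms(4) by (rule Ck_on_imp_continuous_on)
  have inv: "invertible (V t)" and decomp: "A (\<gamma> t) = V t ** diag_mat (l t) ** matrix_inv (V t)"
    and diff: "V differentiable (at t)" and contl: "continuous_on UNIV (\<lambda>t. diag_mat (l t))" for t
    using assms(1,11) Ck_on_imp_differentiable[of k V UNIV t] Ck_on_imp_continuous_on
    by (auto simp: parallel_transport_eigendecomposition_def Ck_eigendecomposition_def)
  have per: "\<gamma> (t + 1) = \<gamma> t" for t
    using assms(7) by (simp add: smooth_Jordan_curve_def periodic_with_def)
  have range: "path_image \<gamma> = range \<gamma>" and "simple_path \<gamma>"
    using assms(7) by (rule smooth_Jordan_curve_path_image, rule smooth_Jordan_curve_simple_path)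
  have ins: "\<xi>0 \<in> inside (path_image \<gamma>)"
    using assms(9) by (simp add: encircles_def range)
  have disc: "eig_disc (A (\<gamma> t)) = (l t $ 1 - l t $ 2) ^ 2" for t
    by (rule eig_disc_diagonalization[OF inv decomp])
  \<comment> \<open>A point inside the curve is not on it, so the eigenvalues stay distinct along
    \<open>\<gamma>\<close>.\<close>
  have "\<gamma> t \<in> \<Omega> - {\<xi>0}" for t
    using assms(8) ins by (auto simp: range inside_def)
  then have ne: "l t $ 1 \<noteq> l t $ 2" for t
    using distinct_eigenvals_imp_eig_disc_nonzero[OF assms(6)] disc[of t] by fastforce

  \<comment> \<open>Exchange of the eigenvalues\<close>
  have wn: "norm (winding_number (\<lambda>t. (l t $ 1 - l t $ 2) ^ 2) 0) = 1"
    using norm_winding_number_eig_disc[OF assms(3) contA assms(5,6) \<open>simple_path \<gamma>\<close> _ ins] assms(8)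
    by (simp add: range disc)
  have contd: "continuous_on UNIV (\<lambda>t. l t $ 1 - l t $ 2)"
  proof -
    have "continuous_on UNIV (\<lambda>t. diag_mat (l t) $ 1 $ 1 - diag_mat (l t) $ 2 $ 2)"
      by (intro continuous_intros contl)
    then show ?thesis by (simp add: diag_mat_def)
  qed
  have sq: "(l (t + 1) $ 1 - l (t + 1) $ 2) ^ 2 = (l t $ 1 - l t $ 2) ^ 2" for t
    using disc[of t] disc[of "t + 1"] by (simp add: per)
  \<comment> \<open>The eigenvalue difference is a continuous square root of a discriminant with
    winding number of norm 1.\<close>
  have flip: "l (t + 1) $ 1 - l (t + 1) $ 2 = - (l t $ 1 - l t $ 2)" for t
    by (rule sqrt_of_odd_winding_flips[OF contd _ sq wn]) (use ne in auto)
  have sum: "l (t + 1) $ 1 + l (t + 1) $ 2 = l t $ 1 + l t $ 2" for t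
    using trace_det_diagonalization(1)[OF inv decomp] per by metis
  have swap: "l (t + 1) $ 1 = l t $ 2" "l (t + 1) $ 2 = l t $ 1" for t
    using flip[of t] sum[of t] by algebra+

  \<comment> \<open>The monodromy matrix\<close>
  define C where "C = (\<lambda>t. matrix_inv (V t) ** V (t + 1))"
  \<comment> \<open>\<open>V t\<close> and \<open>V (t + 1)\<close> diagonalize the same matrix,
    because \<open>\<gamma>\<close> has returned.\<close>
  have C: "l t $ i * C t $ i $ j = C t $ i $ j * l (t + 1) $ j" for t i j
    unfolding C_def using decomp[of t] decomp[of "t + 1"]
    by (intro diagonalizations_intertwine inv) (simp add: per)
  \<comment> \<open>After the exchange, a nonzero diagonal entry would equate the two distinct
    eigenvalues.\<close>
  have C0: "C t $ 1 $ 1 = 0" "C t $ 2 $ 2 = 0" for t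
    using C[of t 1 1] C[of t 2 2] ne[of t] by (auto simp: swap)
  have VC: "V (t + 1) = V t ** C t" for t
    unfolding C_def by (simp add: matrix_mul_assoc matrix_inv_mult_self(2)[OF inv])
  define c where "c = (\<lambda>t. C t $ 2 $ 1)"
  define d where "d = (\<lambda>t. C t $ 1 $ 2)"
  have c: "V (t + 1) $ r $ 1 = V t $ r $ 2 * c t"
    and d: "V (t + 1) $ r $ 2 = V t $ r $ 1 * d t" for t r
    unfolding VC c_def d_def by (simp_all add: matrix_matrix_mult_def sum_2 C0)

  \<comment> \<open>Moduli and arguments of the swap coefficients\<close>
  have norm_col: "norm (column j (V t)) = ?N j" for j t
    using assms(11) unfolding parallel_transport_eigendecomposition_def
    by (intro norm_column_parallel_transport_const inv diff) blast
  have real: "?P t $ j $ j = of_real (Re (?P t $ j $ j))" for t j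
    using assms(11) by (simp add: parallel_transport_eigendecomposition_def complex_eq_iff)
  have N: "?N j > 0" for j
  proof -
    have "column j (V 0) \<noteq> 0"
      using inv[of 0] det_zero_column invertible_det_nz by blast
    then show ?thesis by simp
  qed
  have norm_c: "norm (c t) = ?N 1 / ?N 2" and norm_d: "norm (d t) = ?N 2 / ?N 1" for t
  proof -
    have "column 1 (V (t + 1)) = c t *s column 2 (V t)" "column 2 (V (t + 1)) = d t *s column 1 (V t)"
      by (simp_all add: vec_eq_iff column_def c d mult.commute)
    moreover have scale: "norm (a *s v) = norm a * norm v" for a :: complex and v :: "complex^2"
      by (simp add: norm_vec_def norm_mult L2_set_right_distrib)
    ultimately have "?N 1 = norm (c t) * ?N 2" "?N 2 = norm (d t) * ?N 1"
      using norm_col by metis+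
    then show "norm (c t) = ?N 1 / ?N 2" "norm (d t) = ?N 2 / ?N 1"
      using N[of 1] N[of 2] by (metis nonzero_eq_divide_eq less_irrefl)+
  qed
  have nz: "c t \<noteq> 0" "d t \<noteq> 0" for t
    using norm_c[of t] norm_d[of t] N[of 1] N[of 2] by auto
  have const: "c t = c 0" "d t = d 0" for t
  proof -
    \<comment> \<open>The diagonal of \<open>?P\<close> is real, so \<open>c t\<close> is a positive
      multiple of \<open>c 0\<close>; its constant modulus makes the factor 1.\<close>
    have "(c has_vector_derivative of_real (Re (?P (t + 1) $ 1 $ 1) - Re (?P t $ 2 $ 2)) * c t) (at t)" for t
      using column_swap_coefficient_derivative[OF _ inv diff c d, of t]
      by (simp flip: real)
    from positive_ratio_of_real_log_derivative[of c, OF this nz(1), of t]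
    obtain \<rho> where "\<rho> > 0" "c t = of_real \<rho> * c 0" by blast
    moreover have "norm (c t) = norm (c 0)"
      by (simp only: norm_c)
    ultimately show "c t = c 0"
      using nz(1)[of 0] by (simp add: norm_mult)
    have "(d has_vector_derivative of_real (Re (?P (t + 1) $ 2 $ 2) - Re (?P t $ 1 $ 1)) * d t) (at t)" for t
      using column_swap_coefficient_derivative[OF _ inv diff d c, of t]
      by (simp flip: real)
    from positive_ratio_of_real_log_derivative[of d, OF this nz(2), of t]
    obtain \<rho> where "\<rho> > 0" "d t = of_real \<rho> * d 0" by blast
    moreover have "norm (d t) = norm (d 0)"
      by (simp only: norm_d)
    ultimately show "d t = d 0"
      using nz(2)[of 0] by (simp add: norm_mult)
  qed
  have cd: "c 0 * d 0 = - 1"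
  proof -
    have det_nz: "det (V t) \<noteq> 0" for t
      using inv invertible_det_nz by blast
    have "trace (?P t) = of_real (Re (trace (?P t)))" for t
      using real[of t 1] real[of t 2] by (simp add: trace_def sum_2 complex_eq_iff)
    then have "((\<lambda>t. det (V t)) has_vector_derivative of_real (Re (trace (?P t))) * det (V t)) (at t)" for t
      using has_vector_derivative_det_transport[OF inv diff, of t] by simp
    from positive_ratio_of_real_log_derivative[of "\<lambda>t. det (V t)", OF this det_nz, of 1]
    obtain \<rho> where \<rho>: "\<rho> > 0" "det (V 1) = of_real \<rho> * det (V 0)" by blast
    \<comment> \<open>The minus sign comes from interchanging the two columns.\<close>
    have "det (V 1) = - (c 0 * d 0) * det (V 0)"
      using c[of 0] d[of 0] by (simp add: det_2 algebra_simps)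
    with \<rho>(2) det_nz[of 0] have eq: "c 0 * d 0 = - of_real \<rho>"
      by (metis minus_minus mult_right_cancel)
    \<comment> \<open>The two norm ratios are reciprocal, which forces
      \<open>\<rho> = 1\<close>.\<close>
    have "norm (c 0 * d 0) = 1"
      using N[of 1] N[of 2] by (simp add: norm_mult norm_c norm_d)
    with eq \<rho>(1) show ?thesis by simp
  qed
  define \<alpha>1 where "\<alpha>1 = Arg (c 0)"
  have c0: "c 0 = of_real (?N 1 / ?N 2) * exp (\<i> * of_real \<alpha>1)"
    using Arg_eq[OF nz(1)[of 0]] by (simp only: norm_c \<alpha>1_def)
  \<comment> \<open>The second angle is forced by \<open>c 0 * d 0 = - 1\<close>: the norm ratios
    cancel and the exponentials must multiply to -1.\<close>
  have d0: "d 0 = of_real (?N 2 / ?N 1) * exp (\<i> * of_real (pi - \<alpha>1))"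
  proof -
    have "c 0 * (of_real (?N 2 / ?N 1) * exp (\<i> * of_real (pi - \<alpha>1)))
        = of_real ((?N 1 / ?N 2) * (?N 2 / ?N 1)) * (exp (\<i> * of_real \<alpha>1) * exp (\<i> * of_real (pi - \<alpha>1)))"
      unfolding c0 by (simp only: of_real_mult mult_ac)
    also have "exp (\<i> * of_real \<alpha>1) * exp (\<i> * of_real (pi - \<alpha>1)) = - 1"
      unfolding exp_add[symmetric] by (simp add: algebra_simps)
    also have "of_real ((?N 1 / ?N 2) * (?N 2 / ?N 1)) * - 1 = c 0 * d 0"
      using N[of 1] N[of 2] cd by simp
    finally show ?thesis
      using nz(1)[of 0] by (metis mult_left_cancel)
  qed
  have final: "matrix_inv (V t) ** V (t + 1) =
      vector [vector [0, of_real (?N 2 / ?N 1) * exp (\<i> * of_real (pi - \<alpha>1))],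
              vector [of_real (?N 1 / ?N 2) * exp (\<i> * of_real \<alpha>1), 0]]" for t
    using C0[of t] const[of t] unfolding c0 d0 unfolding C_def c_def d_def
    by (simp add: vec_eq_iff forall_2)
  show ?thesis
  proof (intro exI conjI allI impI)
    show "[\<alpha>1 + (pi - \<alpha>1) = pi] (rmod (2 * pi))"
      by simp
    show "matrix_inv (V t) ** V (t + 1) =
        vector [vector [0, exp (\<i> * of_real (pi - \<alpha>1))], vector [exp (\<i> * of_real \<alpha>1), 0]]"
      if "?N 1 = ?N 2" for t
      using final[of t] that N[of 1] N[of 2] by simp
  qed (fact swap final)+
qed

end
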